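(* For every integer $d\ge 3$ there exists a constant $0<c<1$ such that for every integer $n\ge d$ there exists a $d$-regular bipartite simple graph $G$ on $2n$ vertices and an edge $e$ of $G$ with \[p(e)>1-c^{n}.\]
   Context: For a finite graph $G$ admitting at least one perfect matching and an edge $e$ of $G$, $p(e)$ denotes the probability that $e$ is contained in a perfect matching of $G$ chosen uniformly at random among all perfect matchings of $G$. (Every $d$-regular bipartite graph with $d\ge1$ has a perfect matching.) *)

theory Defs
  imports "HOL-Probability.Probability"
begin

text \<open>A finite simple graph is given by its vertex set \<open>V\<close> and its set \<open>E\<close> of edges, an edge being
  the two-element set of its endpoints.\<close>

definition finite_simple_graph :: "'a set \<Rightarrow> 'a set set \<Rightarrow> bool" where
  "finite_simple_graph V E \<longleftrightarrow> finite V \<and> (\<forall>e\<in>E. e \<subseteq> V \<and> card e = 2)"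

definition bipartite_graph :: "'a set \<Rightarrow> 'a set set \<Rightarrow> bool" where
  "bipartite_graph V E \<longleftrightarrow>
     (\<exists>X Y. X \<union> Y = V \<and> X \<inter> Y = {} \<and> (\<forall>e\<in>E. \<exists>x\<in>X. \<exists>y\<in>Y. e = {x, y}))"

definition degree :: "'a set set \<Rightarrow> 'a \<Rightarrow> nat" where
  "degree E v = card {e \<in> E. v \<in> e}"

definition regular_graph :: "nat \<Rightarrow> 'a set \<Rightarrow> 'a set set \<Rightarrow> bool" where
  "regular_graph d V E \<longleftrightarrow> (\<forall>v\<in>V. degree E v = d)"

definition perfect_matchings :: "'a set \<Rightarrow> 'a set set \<Rightarrow> 'a set set set" where
  "perfect_matchings V E = {M. M \<subseteq> E \<and> (\<forall>v\<in>V. \<exists>!e. e \<in> M \<and> v \<in> e)}"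

text \<open>\<open>pmf_of_set\<close> is the uniform distribution only on a finite nonempty set, so the following is
  meaningful only for finite graphs that have a perfect matching.\<close>

definition edge_prob :: "'a set \<Rightarrow> 'a set set \<Rightarrow> 'a set \<Rightarrow> real" where
  "edge_prob V E e = measure_pmf.prob (pmf_of_set (perfect_matchings V E)) {M. e \<in> M}"

end

theory Submission
  imports Defs
begin

text \<open>Replace an edge \<open>f = xy\<close> of a \<open>d\<close>-regular bipartite graph by a copy of \<open>K\<^bsub>d,d\<^esub>\<close> minus an edge
  \<open>ab\<close>, joined to the rest by \<open>xb\<close> and \<open>ay\<close>. The graph stays \<open>d\<close>-regular, and by parity a perfect
  matching uses both or none of the two new links. In the first case it extends a matching through
  \<open>f\<close> in \<open>(d-1)!\<close> ways, in the second a matching avoiding \<open>f\<close> in \<open>d! - (d-1)! = (d-1)(d-1)!\<close> ways.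
  So each replacement divides the odds of \<open>f\<close> by \<open>d - 1 \<ge> 2\<close>. Doing this \<open>k\<close> times on each of the
  \<open>d - 1\<close> edges other than \<open>e\<close> at a fixed vertex makes these edges exponentially unlikely, while the
  order grows linearly in \<open>k\<close>. Base graphs of order \<open>m\<close> with \<open>d \<le> m < d\<^sup>2\<close> reach every \<open>n\<close>.\<close>

text \<open>A bipartite graph with classes of size \<open>n\<close> is encoded as a relation on \<open>{..<n}\<close>, from left to
  right vertices, and a perfect matching as a permutation contained in it.\<close>

definition biregular :: "nat \<Rightarrow> nat \<Rightarrow> (nat \<times> nat) set \<Rightarrow> bool" where
  "biregular d n R \<longleftrightarrow> R \<subseteq> {..<n} \<times> {..<n} \<and>
     (\<forall>i<n. card (R `` {i}) = d) \<and> (\<forall>j<n. card (R\<inverse> `` {j}) = d)"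

definition matching_perms :: "nat \<Rightarrow> (nat \<times> nat) set \<Rightarrow> (nat \<Rightarrow> nat) set" where
  "matching_perms n R = {p. p permutes {..<n} \<and> (\<forall>i<n. (i, p i) \<in> R)}"

definition perms_through :: "nat \<Rightarrow> (nat \<times> nat) set \<Rightarrow> nat \<Rightarrow> nat \<Rightarrow> (nat \<Rightarrow> nat) set" where
  "perms_through n R i j = {p \<in> matching_perms n R. p i = j}"

section \<open>Counting permutations\<close>

text \<open>By finiteness and injectivity, a permutation mapping \<open>A\<close> into
  \<open>A\<close> maps it onto \<open>A\<close>, hence \<open>B\<close> onto \<open>B\<close>; its
  two restrictions are independent. With \<open>A\<close> the old vertices and \<open>B\<close> the
  new block, this makes matching counts factor.\<close>

lemma card_permutes_split:
  assumes fin: "finite A" "finite B" and disj: "A \<inter> B = {}"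
  shows "card {r. r permutes A \<union> B \<and> r ` A \<subseteq> A \<and> (\<forall>i\<in>A. P i (r i)) \<and> (\<forall>i\<in>B. Q i (r i))} =
    card {p. p permutes A \<and> (\<forall>i\<in>A. P i (p i))} * card {q. q permutes B \<and> (\<forall>i\<in>B. Q i (q i))}"
    (is "card ?R = card ?S * card ?T")
proof -
  have "bij_betw (\<lambda>(p, q). p \<circ> q) (?S \<times> ?T) ?R"
  proof (rule bij_betwI[where g = "\<lambda>r. (\<lambda>i. if i \<in> A then r i else i, \<lambda>i. if i \<in> B then r i else i)"])
    show "(\<lambda>(p, q). p \<circ> q) \<in> ?S \<times> ?T \<rightarrow> ?R"
    proof (clarsimp, intro conjI ballI)
      fix p q
      assume p: "p permutes A" "\<forall>i\<in>A. P i (p i)" and q: "q permutes B" "\<forall>i\<in>B. Q i (q i)"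
      have qA: "q i = i" if "i \<in> A" for i
        using that disj q(1) by (auto simp: permutes_def)
      have pB: "p (q i) = q i" if "i \<in> B" for i
        using that disj p(1) permutes_in_image[OF q(1)] by (auto simp: permutes_def)
      show "p \<circ> q permutes A \<union> B"
        by (meson p q permutes_compose permutes_subset sup_ge1 sup_ge2)
      show "(\<lambda>x. p (q x)) ` A \<subseteq> A"
        using permutes_in_image[OF p(1)] by (auto simp: qA)
      show "P i (p (q i))" if "i \<in> A" for i using that p qA by simp
      show "Q i (p (q i))" if "i \<in> B" for i using that q pB by simp
    qed
    show "(\<lambda>r. (\<lambda>i. if i \<in> A then r i else i, \<lambda>i. if i \<in> B then r i else i)) \<in> ?R \<rightarrow> ?S \<times> ?T"
    proof (clarsimp, intro conjI)
      fix r
      assume r: "r permutes A \<union> B" "r ` A \<subseteq> A"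
      have inj: "inj_on r X" for X
        using permutes_inj[OF r(1)] by (rule inj_on_subset) simp
      have rA: "r ` A = A"
        by (rule endo_inj_surj[OF fin(1) r(2) inj])
      have rB: "r ` B = B"
      proof -
        have "B = (A \<union> B) - A" using disj by blast
        then have "r ` B = r ` (A \<union> B) - r ` A"
          using image_set_diff[OF permutes_inj[OF r(1)]] by metis
        then show ?thesis using permutes_image[OF r(1)] rA disj by auto
      qed
      have "bij_betw (\<lambda>i. if i \<in> A then r i else i) A A"
        using rA inj by (simp add: bij_betw_def inj_on_def)
      then show "(\<lambda>i. if i \<in> A then r i else i) permutes A"
        by (rule bij_imp_permutes) simp
      have "bij_betw (\<lambda>i. if i \<in> B then r i else i) B B"
        using rB inj by (simp add: bij_betw_def inj_on_def)
      then show "(\<lambda>i. if i \<in> B then r i else i) permutes B"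
        by (rule bij_imp_permutes) simp
    qed
    show "(\<lambda>i. if i \<in> A then ((\<lambda>(p, q). p \<circ> q) pq) i else i,
           \<lambda>i. if i \<in> B then ((\<lambda>(p, q). p \<circ> q) pq) i else i) = pq"
      if pq_in: "pq \<in> ?S \<times> ?T" for pq
    proof -
      obtain p q where pq: "pq = (p, q)" and p: "p permutes A" and q: "q permutes B"
        using pq_in by auto
      show ?thesis
        using disj p q permutes_in_image[OF q] unfolding pq
        by (auto simp: fun_eq_iff permutes_def)
    qed
    show "(\<lambda>(p, q). p \<circ> q) (\<lambda>i. if i \<in> A then r i else i, \<lambda>i. if i \<in> B then r i else i) = r"
      if "r \<in> ?R" for r
    proof -
      have r: "r permutes A \<union> B" "r ` A \<subseteq> A" using that by auto
      have rA: "r ` A = A"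
        using endo_inj_surj[OF fin(1) r(2)] inj_on_subset[OF permutes_inj[OF r(1)]] by simp
      have "r i \<notin> A" if "i \<in> B" for i
        using that rA disj permutes_inj[OF r(1)] by (metis disjoint_iff imageE inj_eq)
      then show ?thesis
        using r(1) disj by (auto simp: fun_eq_iff permutes_def)
    qed
  qed
  then have "card (?S \<times> ?T) = card ?R" by (rule bij_betw_same_card)
  then show ?thesis by (simp add: card_cartesian_product)
qed

lemma card_permutes_fixing:
  assumes "finite B" "b \<in> B"
  shows "card {q. q permutes B \<and> q b = b} = fact (card B - 1)"
proof -
  have "q permutes B \<and> q b = b \<longleftrightarrow> q permutes (B - {b})" for q
  proof
    assume q: "q permutes B \<and> q b = b"
    show "q permutes (B - {b})"
      by (rule permutes_superset[OF conjunct1[OF q]]) (use q assms(2) in auto)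
  next
    assume "q permutes (B - {b})"
    then show "q permutes B \<and> q b = b"
      using permutes_subset[of q "B - {b}" B] permutes_not_in[of q "B - {b}" b] by simp
  qed
  then show ?thesis
    using assms card_permutations[of "B - {b}" "card B - 1"] by simp
qed

text \<open>These are the perfect matchings of a complete bipartite graph on two copies of
  \<open>B\<close> without the edge \<open>(b, b)\<close>.\<close>

lemma card_permutes_moving:
  assumes "finite B" "b \<in> B"
  shows "card {q. q permutes B \<and> q b \<noteq> b} = (card B - 1) * fact (card B - 1)"
proof -
  have "{q. q permutes B \<and> q b \<noteq> b} = {q. q permutes B} - {q. q permutes B \<and> q b = b}" by auto
  then have "card {q. q permutes B \<and> q b \<noteq> b} =
      card {q. q permutes B} - card {q. q permutes B \<and> q b = b}"
    using finite_permutations[OF assms(1)] by (simp add: card_Diff_subset Collect_mono)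
  then have "card {q. q permutes B \<and> q b \<noteq> b} = fact (card B) - fact (card B - 1)"
    unfolding card_permutes_fixing[OF assms] card_permutations[OF refl assms(1)] .
  moreover have "card B > 0" using assms by (auto simp: card_gt_0_iff)
  ultimately show ?thesis by (simp add: fact_reduce algebra_simps)
qed

section \<open>Inserting a block into an edge\<close>

text \<open>In the added block \<open>{n..<n+d}\<close> the omitted edge is \<open>(n, n)\<close>. The link \<open>(x, n)\<close> inherits the
  role of \<open>(x, y)\<close>.\<close>

definition insert_block :: "nat \<Rightarrow> nat \<Rightarrow> nat \<Rightarrow> nat \<Rightarrow> (nat \<times> nat) set \<Rightarrow> (nat \<times> nat) set" where
  "insert_block d n x y R =
     (R - {(x, y)}) \<union> {(x, n), (n, y)} \<union> ({n..<n+d} \<times> {n..<n+d} - {(n, n)})"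

text \<open>Reduces column degrees to row degrees; the symmetry holds because the omitted edge
  \<open>(n, n)\<close> is diagonal.\<close>

lemma insert_block_converse: "(insert_block d n x y R)\<inverse> = insert_block d n y x (R\<inverse>)"
  by (auto simp: insert_block_def)

lemma insert_block_rows:
  assumes R: "R \<subseteq> {..<n} \<times> {..<n}" "\<And>i. i < n \<Longrightarrow> card (R `` {i}) = d"
    and xy: "(x, y) \<in> R" and d: "d > 0" and i: "i < n + d"
  shows "card (insert_block d n x y R `` {i}) = d"
proof -
  have lt: "x < n" "y < n" using R(1) xy by auto
  have fin: "finite (R `` {x})" by (rule finite_subset[of _ "{..<n}"]) (use R(1) in auto)
  \<comment> \<open>Row \<open>x\<close> trades \<open>y\<close> for \<open>n\<close>, and row
    \<open>n\<close> has \<open>y\<close> in place of the omitted \<open>n\<close>; the rest are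
    untouched old rows or full block rows.\<close>
  consider "i = x" | "i < n" "i \<noteq> x" | "i = n" | "n < i" by linarith
  then show ?thesis
  proof cases
    case 1
    then have "insert_block d n x y R `` {i} = insert n (R `` {x} - {y})"
      using lt by (auto simp: insert_block_def)
    moreover have "n \<notin> R `` {x}" using R(1) by auto
    ultimately show ?thesis using R(2)[OF lt(1)] fin xy d by auto
  next
    case 2
    then have "insert_block d n x y R `` {i} = R `` {i}"
      by (auto simp: insert_block_def)
    then show ?thesis using R(2) 2 by simp
  next
    case 3
    then have "insert_block d n x y R `` {i} = insert y {n<..<n+d}"
      using lt R(1) d by (auto simp: insert_block_def)
    then show ?thesis using lt d by simp
  next
    case 4
    then have "insert_block d n x y R `` {i} = {n..<n+d}"
      using lt R(1) d i by (auto simp: insert_block_def)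
    then show ?thesis by simp
  qed
qed

lemma biregular_insert_block:
  assumes R: "biregular d n R" and xy: "(x, y) \<in> R" and d: "d > 0"
  shows "biregular d (n + d) (insert_block d n x y R)"
  unfolding biregular_def
proof (intro conjI allI impI)
  show "insert_block d n x y R \<subseteq> {..<n + d} \<times> {..<n + d}"
    using R xy d by (fastforce simp: biregular_def insert_block_def)
  show "card (insert_block d n x y R `` {i}) = d" if "i < n + d" for i
    using R that by (intro insert_block_rows xy d) (auto simp: biregular_def)
  show "card ((insert_block d n x y R)\<inverse> `` {i}) = d" if "i < n + d" for i
    unfolding insert_block_converse using R xy that d
    by (intro insert_block_rows) (auto simp: biregular_def)
qed

lemma perms_through_insert_block_other:
  assumes R: "R \<subseteq> {..<n} \<times> {..<n}" and xy: "(x, y) \<in> R" and xj: "(x, j) \<in> R" "j \<noteq> y"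
    and d: "d > 0"
  shows "card (perms_through (n + d) (insert_block d n x y R) x j) =
    card (perms_through n R x j) * ((d - 1) * fact (d - 1))"
proof -
  have lt: "x < n" "y < n" "j < n" using R xy xj by auto
  have un: "{..<n + d} = {..<n} \<union> {n..<n + d}" by auto
  let ?P = "\<lambda>i l. (i, l) \<in> R \<and> (i = x \<longrightarrow> l = j)" and ?Q = "\<lambda>i l. i = n \<longrightarrow> l \<noteq> n"
  let ?L = "perms_through (n + d) (insert_block d n x y R) x j"
  let ?M = "{r. r permutes {..<n} \<union> {n..<n + d} \<and> r ` {..<n} \<subseteq> {..<n} \<and>
       (\<forall>i\<in>{..<n}. ?P i (r i)) \<and> (\<forall>i\<in>{n..<n + d}. ?Q i (r i))}"
  have "?L = ?M"
  proof (intro set_eqI iffI)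
    fix r assume "r \<in> ?L"
    then have r: "r permutes {..<n + d}" "r x = j"
      and e: "\<And>i. i < n + d \<Longrightarrow> (i, r i) \<in> insert_block d n x y R"
      by (auto simp: perms_through_def matching_perms_def)
    have "?P i (r i)" if "i < n" for i
      using e[of i] that r(2) lt by (auto simp: insert_block_def)
    moreover have "r n \<noteq> n" using e[of n] lt d by (auto simp: insert_block_def dest: subsetD[OF R])
    ultimately show "r \<in> ?M" using r(1) R by (auto simp flip: un)
  next
    fix r assume r: "r \<in> ?M"
    have p: "r permutes {..<n + d}" using r un by simp
    have sub: "r ` {..<n} \<subseteq> {..<n}" using r by auto
    have "r ` {..<n} = {..<n}"
      using endo_inj_surj[OF _ sub] inj_on_subset[OF permutes_inj[OF p]] by simp
    then have ge: "r i \<ge> n" if "i \<ge> n" for i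
      using that permutes_inj[OF p] by (metis imageE inj_eq lessThan_iff not_less)
    \<comment> \<open>The deletion of \<open>(x, y)\<close> does no harm, since
      \<open>r x = j\<close> and \<open>j \<noteq> y\<close>.\<close>
    have "(i, r i) \<in> insert_block d n x y R" if "i < n + d" for i
      using that r ge[of i] permutes_in_image[OF p, of i] xj(2)
      by (cases "i < n") (auto simp: insert_block_def)
    then show "r \<in> ?L" using p r lt by (auto simp: perms_through_def matching_perms_def)
  qed
  then have "card ?L = card ?M" by (rule arg_cong)
  also have "\<dots> = card {p. p permutes {..<n} \<and> (\<forall>i\<in>{..<n}. ?P i (p i))} *
      card {q. q permutes {n..<n + d} \<and> (\<forall>i\<in>{n..<n + d}. ?Q i (q i))}"
    by (rule card_permutes_split) auto
  finally have split: "card ?L = card {p. p permutes {..<n} \<and> (\<forall>i\<in>{..<n}. ?P i (p i))} *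
      card {q. q permutes {n..<n + d} \<and> (\<forall>i\<in>{n..<n + d}. ?Q i (q i))}" .
  have P: "{p. p permutes {..<n} \<and> (\<forall>i\<in>{..<n}. ?P i (p i))} = perms_through n R x j"
    using lt by (auto simp: perms_through_def matching_perms_def)
  have Q: "{q. q permutes {n..<n + d} \<and> (\<forall>i\<in>{n..<n + d}. ?Q i (q i))} =
      {q. q permutes {n..<n + d} \<and> q n \<noteq> n}"
    using d by auto
  show ?thesis using split unfolding P Q using card_permutes_moving[of "{n..<n + d}" n] d by simp
qed

text \<open>A matching through \<open>(x, n)\<close> must also use \<open>(n, y)\<close>. Swapping
  the images of \<open>x\<close> and \<open>n\<close> replaces these links by \<open>(x, y)\<close>
  and \<open>(n, n)\<close>, after which old part and block are again matched separately.\<close>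

lemma perms_through_insert_block_same:
  assumes R: "R \<subseteq> {..<n} \<times> {..<n}" and xy: "(x, y) \<in> R" and d: "d > 0"
  shows "card (perms_through (n + d) (insert_block d n x y R) x n) =
    card (perms_through n R x y) * fact (d - 1)"
proof -
  have lt: "x < n" "y < n" using R xy by auto
  have un: "{..<n + d} = {..<n} \<union> {n..<n + d}" by auto
  let ?P = "\<lambda>i l. (i, l) \<in> R \<and> (i = x \<longrightarrow> l = y)" and ?Q = "\<lambda>i l. i = n \<longrightarrow> l = n"
  let ?t = "Transposition.transpose x n"
  let ?L = "perms_through (n + d) (insert_block d n x y R) x n"
  let ?M = "{r. r permutes {..<n} \<union> {n..<n + d} \<and> r ` {..<n} \<subseteq> {..<n} \<and>
       (\<forall>i\<in>{..<n}. ?P i (r i)) \<and> (\<forall>i\<in>{n..<n + d}. ?Q i (r i))}"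
  have t: "?t permutes {..<n + d}" using lt d by (intro permutes_swap_id) auto
  have "bij_betw (\<lambda>r. r \<circ> ?t) ?L ?M"
  proof (rule bij_betwI[where g = "\<lambda>r. r \<circ> ?t"])
    show "(\<lambda>r. r \<circ> ?t) \<in> ?L \<rightarrow> ?M"
    proof
      fix r assume "r \<in> ?L"
      then have r: "r permutes {..<n + d}" "r x = n"
        and e: "\<And>i. i < n + d \<Longrightarrow> (i, r i) \<in> insert_block d n x y R"
        by (auto simp: perms_through_def matching_perms_def)
      \<comment> \<open>Otherwise the left block vertices are matched within the block, hence onto
        its right vertices, and \<open>n\<close> is the image of one of them as well as of
        \<open>x\<close>.\<close>
      have rn: "r n = y"
      proof (rule ccontr)
        assume "r n \<noteq> y"
        then have "r ` {n..<n + d} \<subseteq> {n..<n + d}"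
          using e R lt by (force simp: insert_block_def)
        then have "r ` {n..<n + d} = {n..<n + d}"
          using endo_inj_surj inj_on_subset[OF permutes_inj[OF r(1)]]
          by (metis finite_atLeastLessThan subset_UNIV)
        then obtain i where "i \<ge> n" "r i = n"
          using d by (metis atLeastLessThan_iff imageE le_refl less_add_same_cancel1)
        then show False using r(2) permutes_inj[OF r(1)] lt by (metis inj_eq not_less)
      qed
      have "?P i ((r \<circ> ?t) i)" if "i < n" for i
      proof (cases "i = x")
        case True
        then show ?thesis using rn xy by simp
      next
        case False
        then show ?thesis using e[of i] that by (auto simp: insert_block_def Transposition.transpose_def)
      qed
      moreover have "(r \<circ> ?t) n = n" using r(2) by simp
      moreover have "r \<circ> ?t permutes {..<n + d}" using permutes_compose[OF t r(1)] .
      ultimately show "r \<circ> ?t \<in> ?M" using R by (auto simp flip: un)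
    qed
    show "(\<lambda>r. r \<circ> ?t) \<in> ?M \<rightarrow> ?L"
    proof
      fix r assume r: "r \<in> ?M"
      have p: "r permutes {..<n + d}" using r un by simp
      have sub: "r ` {..<n} \<subseteq> {..<n}" using r by auto
      have "r ` {..<n} = {..<n}"
        using endo_inj_surj[OF _ sub] inj_on_subset[OF permutes_inj[OF p]] by simp
      then have ge: "r i \<ge> n" if "i \<ge> n" for i
        using that permutes_inj[OF p] by (metis imageE inj_eq lessThan_iff not_less)
      have rn: "r n = n" "r x = y" using r lt d by auto
      have "(i, (r \<circ> ?t) i) \<in> insert_block d n x y R" if i: "i < n + d" for i
      proof -
        consider "i = x" | "i = n" | "i < n" "i \<noteq> x" | "i > n" by linarith
        then show ?thesis
        proof cases
          case 4
          then show ?thesis using ge[of i] permutes_in_image[OF p, of i] i lt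
            by (auto simp: insert_block_def Transposition.transpose_def)
        qed (use r rn in \<open>auto simp: insert_block_def Transposition.transpose_def\<close>)
      qed
      moreover have "r \<circ> ?t permutes {..<n + d}" using permutes_compose[OF t p] .
      ultimately show "r \<circ> ?t \<in> ?L" using rn by (auto simp: perms_through_def matching_perms_def)
    qed
  qed (simp_all add: comp_assoc)
  then have "card ?L = card ?M" by (rule bij_betw_same_card)
  also have "\<dots> = card {p. p permutes {..<n} \<and> (\<forall>i\<in>{..<n}. ?P i (p i))} *
      card {q. q permutes {n..<n + d} \<and> (\<forall>i\<in>{n..<n + d}. ?Q i (q i))}"
    by (rule card_permutes_split) auto
  finally have split: "card ?L = card {p. p permutes {..<n} \<and> (\<forall>i\<in>{..<n}. ?P i (p i))} *
      card {q. q permutes {n..<n + d} \<and> (\<forall>i\<in>{n..<n + d}. ?Q i (q i))}" .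
  have P: "{p. p permutes {..<n} \<and> (\<forall>i\<in>{..<n}. ?P i (p i))} = perms_through n R x y"
    using lt by (auto simp: perms_through_def matching_perms_def)
  have Q: "{q. q permutes {n..<n + d} \<and> (\<forall>i\<in>{n..<n + d}. ?Q i (q i))} =
      {q. q permutes {n..<n + d} \<and> q n = n}"
    using d by auto
  show ?thesis using split unfolding P Q using card_permutes_fixing[of "{n..<n + d}" n] d by simp
qed

section \<open>Repeated insertion at a fixed vertex\<close>

text \<open>\<open>w i\<close> counts the perfect matchings through the \<open>i\<close>-th edge at the left vertex \<open>0\<close>; the
  enumeration \<open>g\<close> lets a link take over the index of the edge that it replaces.\<close>

definition matching_profile :: "nat \<Rightarrow> nat \<Rightarrow> (nat \<Rightarrow> nat) \<Rightarrow> bool" where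
  "matching_profile d n w \<longleftrightarrow> (\<exists>R g. biregular d n R \<and> bij_betw g {..<d} (R `` {0}) \<and>
     (\<forall>i<d. card (perms_through n R 0 (g i)) = w i))"

lemma matching_profile_step:
  assumes "matching_profile d n w" and i: "i < d"
  shows "matching_profile d (n + d) (\<lambda>j. fact (d - 1) * (if j = i then 1 else d - 1) * w j)"
proof -
  obtain R g where R: "biregular d n R" and g: "bij_betw g {..<d} (R `` {0})"
    and w: "\<And>j. j < d \<Longrightarrow> card (perms_through n R 0 (g j)) = w j"
    using assms(1) by (auto simp: matching_profile_def)
  have sub: "R \<subseteq> {..<n} \<times> {..<n}" using R by (simp add: biregular_def)
  have e: "(0, g j) \<in> R" if "j < d" for j using bij_betwE[OF g] that by auto
  have ne: "g j \<noteq> g i" if "j < d" "j \<noteq> i" for j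
    using g that i by (auto simp: bij_betw_def inj_on_def)
  have n: "n > 0" "g j < n" if "j < d" for j using e[of j] that sub by auto
  let ?R = "insert_block d n 0 (g i) R" and ?g = "g(i := n)"
  have "biregular d (n + d) ?R" using biregular_insert_block[OF R e[OF i]] i by simp
  moreover have "bij_betw ?g {..<d} (?R `` {0})"
  proof -
    have "inj_on ?g {..<d}"
      using g n(2) by (auto simp: bij_betw_def inj_on_def)
    moreover have "?g ` {..<d} = ?R `` {0}"
    proof -
      have "?R `` {0} = insert n (R `` {0} - {g i})"
        using n[OF i] by (auto simp: insert_block_def)
      also have "R `` {0} - {g i} = g ` ({..<d} - {i})"
        using g i by (auto simp: bij_betw_def inj_on_def)
      finally show ?thesis using i by auto
    qed
    ultimately show ?thesis by (simp add: bij_betw_def)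
  qed
  moreover have "card (perms_through (n + d) ?R 0 (?g j)) =
      fact (d - 1) * (if j = i then 1 else d - 1) * w j" if "j < d" for j
    using perms_through_insert_block_same[OF sub e[OF i]]
      perms_through_insert_block_other[OF sub e[OF i] e[OF that] ne[OF that]] w that i
    by (auto simp: mult_ac)
  ultimately show ?thesis unfolding matching_profile_def by blast
qed

text \<open>The list \<open>xs\<close> names the edges to replace in turn; edge \<open>j\<close>
  gains a factor \<open>d - 1\<close> at each entry other than \<open>j\<close>.\<close>

lemma matching_profile_steps:
  assumes "matching_profile d n w" and "set xs \<subseteq> {..<d}"
  shows "matching_profile d (n + d * length xs)
    (\<lambda>j. fact (d - 1) ^ length xs * (d - 1) ^ length (filter (\<lambda>i. i \<noteq> j) xs) * w j)"
  using assms(2)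
proof (induction xs)
  case Nil
  then show ?case using assms(1) by simp
next
  case (Cons i xs)
  have "matching_profile d (n + d * length xs + d)
    (\<lambda>j. fact (d - 1) * (if j = i then 1 else d - 1) *
      (fact (d - 1) ^ length xs * (d - 1) ^ length (filter (\<lambda>i. i \<noteq> j) xs) * w j))"
    using Cons by (intro matching_profile_step) auto
  moreover have "(\<lambda>j. fact (d - 1) * (if j = i then 1 else d - 1) *
      (fact (d - 1) ^ length xs * (d - 1) ^ length (filter (\<lambda>i. i \<noteq> j) xs) * w j)) =
    (\<lambda>j. fact (d - 1) ^ length (i # xs) * (d - 1) ^ length (filter (\<lambda>i. i \<noteq> j) (i # xs)) * w j)"
    by (auto simp: fun_eq_iff)
  ultimately show ?case by (simp add: add_ac)
qed

text \<open>Each of the \<open>k\<close> rounds replaces the edges \<open>1, ..., d - 1\<close> once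
  and never edge \<open>0\<close>. So per round edge \<open>0\<close> gains \<open>d - 1\<close>
  factors \<open>d - 1\<close> and the others only \<open>d - 2\<close>, which puts edge
  \<open>0\<close> ahead by \<open>(d - 1) ^ k\<close>.\<close>

lemma matching_profile_amplify:
  assumes "matching_profile d n w"
  shows "matching_profile d (n + d * (d - 1) * k)
    (\<lambda>j. fact (d - 1) ^ (k * (d - 1)) * (d - 1) ^ (if j \<in> {1..<d} then k * (d - 2) else k * (d - 1)) * w j)"
proof -
  let ?xs = "concat (replicate k [1..<d])"
  have len: "length ?xs = k * (d - 1)" by (induction k) auto
  have "length (filter (\<lambda>i. i \<noteq> j) [1..<d]) = (if j \<in> {1..<d} then d - 2 else d - 1)" for j
  proof -
    have "length (filter (\<lambda>i. i \<noteq> j) [1..<d]) = card ({1..<d} - {j})"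
      by (subst distinct_card[symmetric]) (auto intro: arg_cong[where f = card])
    then show ?thesis by (auto simp: card_Diff_singleton_if)
  qed
  then have flt: "length (filter (\<lambda>i. i \<noteq> j) ?xs) = (if j \<in> {1..<d} then k * (d - 2) else k * (d - 1))" for j
    by (induction k) auto
  have "set ?xs \<subseteq> {..<d}" by auto
  from matching_profile_steps[OF assms this] show ?thesis
    unfolding len flt by (simp add: mult_ac)
qed

section \<open>Base graphs\<close>

lemma card_perms_through_le: "card (perms_through n R i j) \<le> fact n"
proof -
  have "perms_through n R i j \<subseteq> {p. p permutes {..<n}}"
    by (auto simp: perms_through_def matching_perms_def)
  then have "card (perms_through n R i j) \<le> card {p. p permutes {..<n}}"
    by (intro card_mono finite_permutations) auto
  then show ?thesis using card_permutations[of "{..<n}" n] by simp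
qed

text \<open>A circulant relation serves as base. Defining it by the sum \<open>i + l\<close> rather
  than the difference makes it symmetric, so rows settle columns.\<close>

lemma matching_profile_base:
  assumes d: "0 < d" "d \<le> m"
  shows "\<exists>w. matching_profile d m w \<and> w 0 > 0 \<and> (\<forall>j. w j \<le> fact m)"
proof -
  define R where "R = {(i, l). i < m \<and> l < m \<and> (i + l) mod m < d}"
  have row: "card (R `` {i}) = d" if "i < m" for i
  proof -
    \<comment> \<open>Adding \<open>i\<close> permutes the residues modulo \<open>m\<close>, so
      exactly \<open>d\<close> values of \<open>l\<close> land below \<open>d\<close>.\<close>
    have inj: "inj_on (\<lambda>l. (i + l) mod m) {..<m}"
    proof (rule linorder_inj_onI)
      fix a b assume "a < b" "a \<in> {..<m}" "b \<in> {..<m}"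
      then have "\<not> m dvd (i + b) - (i + a)" by (simp add: nat_dvd_not_less)
      then show "(i + a) mod m \<noteq> (i + b) mod m"
        using \<open>a < b\<close> mod_eq_dvd_iff_nat[of "i + a" "i + b" m] by force
    qed auto
    have surj: "(\<lambda>l. (i + l) mod m) ` {..<m} = {..<m}"
      by (rule endo_inj_surj[OF _ _ inj]) (use d in auto)
    have "(\<lambda>l. (i + l) mod m) ` (R `` {i}) = {..<d}"
    proof (intro equalityI subsetI)
      fix t assume "t \<in> {..<d}"
      then have "t \<in> (\<lambda>l. (i + l) mod m) ` {..<m}" unfolding surj using d(2) by simp
      then show "t \<in> (\<lambda>l. (i + l) mod m) ` (R `` {i})"
        using that \<open>t \<in> {..<d}\<close> by (auto simp: R_def)
    qed (auto simp: R_def)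
    moreover have "inj_on (\<lambda>l. (i + l) mod m) (R `` {i})"
      by (rule inj_on_subset[OF inj]) (auto simp: R_def)
    ultimately show ?thesis by (metis card_image card_lessThan)
  qed
  have "R\<inverse> = R" by (auto simp: R_def add.commute)
  then have "biregular d m R" using row by (auto simp: biregular_def R_def)
  moreover have "R `` {0} = {..<d}" using d by (auto simp: R_def)
  then have "bij_betw id {..<d} (R `` {0})" by simp
  ultimately have "matching_profile d m (\<lambda>j. card (perms_through m R 0 j))"
    unfolding matching_profile_def by (intro exI[of _ R] exI[of _ id]) simp
  moreover have "card (perms_through m R 0 0) > 0"
  proof -
    \<comment> \<open>Negation modulo \<open>m\<close>: for \<open>i < m\<close> the sum
      \<open>i + p i\<close> is \<open>0\<close> modulo \<open>m\<close>, and \<open>0\<close> is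
      matched to \<open>0\<close>.\<close>
    define p where "p i = (if 0 < i \<and> i < m then m - i else i)" for i
    have "bij_betw p {..<m} {..<m}"
      by (rule bij_betwI[where g = p]) (auto simp: p_def)
    then have "p permutes {..<m}" by (rule bij_imp_permutes) (auto simp: p_def)
    then have "p \<in> perms_through m R 0 0"
      using d by (auto simp: perms_through_def matching_perms_def R_def p_def)
    moreover have "finite (perms_through m R 0 0)"
      by (rule finite_subset[OF _ finite_permutations[of "{..<m}"]])
        (auto simp: perms_through_def matching_perms_def)
    ultimately show ?thesis by (auto simp: card_gt_0_iff)
  qed
  ultimately show ?thesis using card_perms_through_le by blast
qed

section \<open>From relations to simple graphs\<close>

text \<open>The shift by \<open>n\<close> keeps the two classes disjoint and lets them fill
  \<open>{..<2 * n}\<close>.\<close>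

definition bipartite_edges :: "nat \<Rightarrow> (nat \<times> nat) set \<Rightarrow> nat set set" where
  "bipartite_edges n R = (\<lambda>(i, j). {i, n + j}) ` R"

lemma bipartite_edge_eq_iff:
  assumes "i < n" "i' < n"
  shows "{i, n + j} = {i', n + j'} \<longleftrightarrow> i = i' \<and> j = (j' :: nat)"
  using assms by (auto simp: doubleton_eq_iff)

lemma bipartite_edges_props:
  assumes R: "biregular d n R"
  shows "finite_simple_graph {..<2 * n} (bipartite_edges n R)"
    and "bipartite_graph {..<2 * n} (bipartite_edges n R)"
    and "regular_graph d {..<2 * n} (bipartite_edges n R)"
proof -
  have sub: "R \<subseteq> {..<n} \<times> {..<n}" using R by (simp add: biregular_def)
  show "finite_simple_graph {..<2 * n} (bipartite_edges n R)"
    unfolding finite_simple_graph_def bipartite_edges_def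
    using sub by (auto simp: card_insert_if)
  have "{..<n} \<union> {n..<2 * n} = {..<2 * n}" by auto
  moreover have "\<forall>e\<in>bipartite_edges n R. \<exists>x\<in>{..<n}. \<exists>y\<in>{n..<2 * n}. e = {x, y}"
  proof
    fix e assume "e \<in> bipartite_edges n R"
    then obtain i j where "e = {i, n + j}" "i < n" "j < n"
      using sub by (auto simp: bipartite_edges_def)
    then show "\<exists>x\<in>{..<n}. \<exists>y\<in>{n..<2 * n}. e = {x, y}"
      by (intro bexI[of _ i] bexI[of _ "n + j"]) auto
  qed
  moreover have "{..<n} \<inter> {n..<2 * n} = {}" by auto
  ultimately show "bipartite_graph {..<2 * n} (bipartite_edges n R)"
    unfolding bipartite_graph_def by blast
  show "regular_graph d {..<2 * n} (bipartite_edges n R)"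
    unfolding regular_graph_def
  proof
    fix v assume v: "v \<in> {..<2 * n}"
    show "degree (bipartite_edges n R) v = d"
    proof (cases "v < n")
      case True
      have "{e \<in> bipartite_edges n R. v \<in> e} = (\<lambda>j. {v, n + j}) ` (R `` {v})"
        unfolding bipartite_edges_def using sub True by auto
      moreover have "inj_on (\<lambda>j. {v, n + j}) (R `` {v})"
        using True by (auto simp: inj_on_def doubleton_eq_iff)
      ultimately show ?thesis using R True by (simp add: degree_def card_image biregular_def)
    next
      case False
      then obtain j where j: "v = n + j" "j < n"
        using v by (metis add_less_cancel_left le_Suc_ex lessThan_iff mult_2 not_less)
      have "{e \<in> bipartite_edges n R. v \<in> e} = (\<lambda>i. {i, n + j}) ` (R\<inverse> `` {j})"
        unfolding bipartite_edges_def using sub j by auto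
      moreover have "inj_on (\<lambda>i. {i, n + j}) (R\<inverse> `` {j})"
        using sub by (auto simp: inj_on_def doubleton_eq_iff)
      ultimately show ?thesis using R j by (simp add: degree_def card_image biregular_def)
    qed
  qed
qed

definition perm_matching :: "nat \<Rightarrow> (nat \<Rightarrow> nat) \<Rightarrow> nat set set" where
  "perm_matching n p = (\<lambda>i. {i, n + p i}) ` {..<n}"

lemma perm_matching_iff:
  assumes "i < n"
  shows "{i, n + j} \<in> perm_matching n p \<longleftrightarrow> p i = j"
  using assms by (auto simp: perm_matching_def doubleton_eq_iff)

text \<open>Carries the counting over to permutations. For surjectivity, the matching edge at each
  left vertex defines the map, and uniqueness at right vertices makes it injective.\<close>

lemma bij_betw_perm_matching:
  assumes sub: "R \<subseteq> {..<n} \<times> {..<n}"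
  shows "bij_betw (perm_matching n) (matching_perms n R)
    (perfect_matchings {..<2 * n} (bipartite_edges n R))"
  unfolding bij_betw_def
proof (intro conjI set_eqI iffI)
  show "inj_on (perm_matching n) (matching_perms n R)"
  proof (rule inj_onI)
    fix p q assume p: "p \<in> matching_perms n R" and q: "q \<in> matching_perms n R"
      and eq: "perm_matching n p = perm_matching n q"
    have "p i = q i" for i
    proof (cases "i < n")
      case True
      then show ?thesis using eq perm_matching_iff by metis
    next
      case False
      then show ?thesis using p q by (auto simp: matching_perms_def permutes_not_in)
    qed
    then show "p = q" by auto
  qed
next
  fix M assume "M \<in> perm_matching n ` matching_perms n R"
  then obtain p where p: "p permutes {..<n}" "\<And>i. i < n \<Longrightarrow> (i, p i) \<in> R"
    and M: "M = perm_matching n p"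
    by (auto simp: matching_perms_def)
  have "\<exists>!e. e \<in> M \<and> v \<in> e" if v: "v < 2 * n" for v
  proof (cases "v < n")
    case True
    then show ?thesis
      by (intro ex1I[of _ "{v, n + p v}"]) (auto simp: M perm_matching_def)
  next
    case False
    then have "v - n \<in> p ` {..<n}" using v permutes_image[OF p(1)] by auto
    then obtain i where i: "i < n" "v = n + p i" using False by auto
    show ?thesis
    proof (intro ex1I[of _ "{i, n + p i}"])
      show "{i, n + p i} \<in> M \<and> v \<in> {i, n + p i}" using i by (auto simp: M perm_matching_def)
      fix e assume "e \<in> M \<and> v \<in> e"
      then obtain k where "k < n" "e = {k, n + p k}" "p k = p i"
        using i by (auto simp: M perm_matching_def)
      then show "e = {i, n + p i}" using permutes_inj[OF p(1)] by (auto simp: inj_eq)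
    qed
  qed
  moreover have "M \<subseteq> bipartite_edges n R"
    using p(2) by (auto simp: M perm_matching_def bipartite_edges_def image_iff)
  ultimately show "M \<in> perfect_matchings {..<2 * n} (bipartite_edges n R)"
    by (simp add: perfect_matchings_def)
next
  fix M assume "M \<in> perfect_matchings {..<2 * n} (bipartite_edges n R)"
  then have ME: "M \<subseteq> bipartite_edges n R"
    and ex1: "\<And>v. v < 2 * n \<Longrightarrow> \<exists>!e. e \<in> M \<and> v \<in> e"
    by (auto simp: perfect_matchings_def)
  have M_form: "\<exists>i j. e = {i, n + j} \<and> (i, j) \<in> R \<and> i < n \<and> j < n" if "e \<in> M" for e
    using that ME sub unfolding bipartite_edges_def by fastforce
  have "\<exists>j. {i, n + j} \<in> M" if "i < n" for i
  proof -
    obtain e where "e \<in> M" "i \<in> e" using ex1[of i] \<open>i < n\<close> by auto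
    then show ?thesis using M_form[of e] \<open>i < n\<close> by auto
  qed
  then obtain f where f: "\<And>i. i < n \<Longrightarrow> {i, n + f i} \<in> M" by metis
  \<comment> \<open>\<open>f\<close> is unspecified from \<open>n\<close> on, where
    \<open>permutes\<close> demands the identity.\<close>
  define p where "p i = (if i < n then f i else i)" for i
  have edge: "(i, p i) \<in> R" if "i < n" for i
    using M_form[OF f[OF that]] that bipartite_edge_eq_iff by (auto simp: p_def)
  have "inj_on p {..<n}"
  proof (rule inj_onI)
    fix a b assume ab: "a \<in> {..<n}" "b \<in> {..<n}" "p a = p b"
    \<comment> \<open>Puts the shared right vertex in range, so that uniqueness of its matching edge
      applies.\<close>
    then have "n + p a < 2 * n" using edge[of a] sub by auto
    then have "{a, n + p a} = {b, n + p b}"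
      using ex1 f[of a] f[of b] ab by (metis insertI1 insert_commute lessThan_iff p_def)
    then show "a = b" using ab by (auto simp: doubleton_eq_iff)
  qed
  moreover have "p ` {..<n} \<subseteq> {..<n}" using edge sub by auto
  ultimately have "bij_betw p {..<n} {..<n}"
    by (simp add: bij_betw_def endo_inj_surj)
  then have perm: "p permutes {..<n}" by (rule bij_imp_permutes) (simp add: p_def)
  have "M = perm_matching n p"
  proof (intro set_eqI iffI)
    fix e assume e: "e \<in> M"
    then obtain i j where ij: "e = {i, n + j}" "i < n" using M_form by blast
    then have "e = {i, n + p i}"
      using ex1[of i] f[of i] e by (auto simp: p_def)
    then show "e \<in> perm_matching n p" using ij by (auto simp: perm_matching_def)
  qed (auto simp: perm_matching_def p_def f)
  then show "M \<in> perm_matching n ` matching_perms n R"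
    using perm edge by (auto simp: matching_perms_def)
qed

text \<open>By \<open>ne\<close>, \<open>pmf_of_set\<close> is genuinely uniform here, so the
  probability is a ratio of cardinalities.\<close>

lemma edge_prob_bipartite:
  assumes sub: "R \<subseteq> {..<n} \<times> {..<n}" and i: "i < n" and ne: "matching_perms n R \<noteq> {}"
  shows "edge_prob {..<2 * n} (bipartite_edges n R) {i, n + j} =
    card (perms_through n R i j) / card (matching_perms n R)"
proof -
  let ?PM = "perfect_matchings {..<2 * n} (bipartite_edges n R)"
  have fin: "finite (matching_perms n R)"
    by (rule finite_subset[OF _ finite_permutations[of "{..<n}"]]) (auto simp: matching_perms_def)
  note bij = bij_betw_perm_matching[OF sub]
  have PM: "?PM = perm_matching n ` matching_perms n R" using bij by (simp add: bij_betw_def)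
  have "?PM \<inter> {M. {i, n + j} \<in> M} = perm_matching n ` perms_through n R i j"
    unfolding PM using i by (auto simp: perms_through_def perm_matching_iff)
  moreover have "inj_on (perm_matching n) (perms_through n R i j)"
    by (rule inj_on_subset[OF bij_betw_imp_inj_on[OF bij]]) (auto simp: perms_through_def)
  ultimately have "card (?PM \<inter> {M. {i, n + j} \<in> M}) = card (perms_through n R i j)"
    by (simp add: card_image)
  then show ?thesis
    unfolding edge_prob_def using fin ne bij_betw_same_card[OF bij]
    by (subst measure_pmf_of_set) (auto simp: PM)
qed

text \<open>Every perfect matching uses exactly one of the \<open>d\<close> edges at the left vertex
  \<open>0\<close>.\<close>

lemma card_matching_perms:
  fixes d :: nat
  assumes g: "bij_betw g {..<d} (R `` {0})" and "n > 0"
  shows "card (matching_perms n R) = (\<Sum>j<d. card (perms_through n R 0 (g j)))"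
proof -
  have fin: "finite (perms_through n R i j)" for i j
    by (rule finite_subset[OF _ finite_permutations[of "{..<n}"]])
      (auto simp: perms_through_def matching_perms_def)
  have "p 0 \<in> g ` {..<d}" if "p \<in> matching_perms n R" for p
    using that assms by (auto simp: matching_perms_def bij_betw_def)
  then have "matching_perms n R = (\<Union>j<d. perms_through n R 0 (g j))"
    by (fastforce simp: perms_through_def)
  also have "card \<dots> = (\<Sum>j<d. card (perms_through n R 0 (g j)))"
    using g fin by (intro card_UN_disjoint ballI finite_lessThan) (auto simp: perms_through_def bij_betw_def inj_on_def)
  finally show ?thesis .
qed

section \<open>Estimates and the choice of the constant\<close>

text \<open>By convexity, \<open>(1 + x) ^ n\<close> lies below its chord between
  \<open>x = 0\<close> and \<open>x = 1\<close>.\<close>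

lemma power_one_plus_le:
  fixes x :: real
  assumes "0 \<le> x" "x \<le> 1"
  shows "(1 + x) ^ n \<le> 1 + x * (2 ^ n - 1)"
proof (induction n)
  case (Suc n)
  have "(1 + x) ^ Suc n \<le> (1 + x) * (1 + x * (2 ^ n - 1))"
    using mult_left_mono[OF Suc, of "1 + x"] assms by simp
  also have "\<dots> = 1 + x * 2 ^ n + x * x * (2 ^ n - 1)" by (simp add: algebra_simps)
  also have "\<dots> \<le> 1 + x * 2 ^ n + x * 1 * (2 ^ n - 1)"
    using assms by (intro add_left_mono mult_right_mono mult_left_mono) auto
  finally show ?case by (simp add: algebra_simps)
qed simp

text \<open>The edge \<open>e\<close> is the one of index \<open>0\<close>; \<open>w 0 > 0\<close>
  supplies a perfect matching, so that \<open>edge_prob\<close> is meaningful.\<close>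

lemma matching_profile_imp_edge:
  assumes prof: "matching_profile d n w" and d: "d > 0" and w0: "w 0 > 0"
  shows "\<exists>(V :: nat set) E e. finite_simple_graph V E \<and> bipartite_graph V E \<and> regular_graph d V E \<and>
    card V = 2 * n \<and> e \<in> E \<and> edge_prob V E e = w 0 / (\<Sum>j<d. w j)"
proof -
  obtain R g where R: "biregular d n R" and g: "bij_betw g {..<d} (R `` {0})"
    and w: "\<And>j. j < d \<Longrightarrow> card (perms_through n R 0 (g j)) = w j"
    using prof by (auto simp: matching_profile_def)
  have sub: "R \<subseteq> {..<n} \<times> {..<n}" using R by (simp add: biregular_def)
  have e: "(0, g 0) \<in> R" using bij_betwE[OF g] d by auto
  then have n: "n > 0" using sub by auto
  have "perms_through n R 0 (g 0) \<noteq> {}" using w[OF d] w0 by auto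
  then have "matching_perms n R \<noteq> {}" by (auto simp: perms_through_def)
  then have "edge_prob {..<2 * n} (bipartite_edges n R) {0, n + g 0} = w 0 / (\<Sum>j<d. w j)"
    using card_matching_perms[OF g n] w d by (simp add: edge_prob_bipartite[OF sub n])
  moreover have "{0, n + g 0} \<in> bipartite_edges n R"
    using e by (force simp: bipartite_edges_def)
  ultimately show ?thesis
    using bipartite_edges_props[OF R] by (intro exI conjI) (assumption | simp)+
qed

text \<open>The lead \<open>(d - 1) ^ k\<close> of edge \<open>0\<close> is at least
  \<open>2 ^ k\<close>. The base counts cost only a constant factor: \<open>w 0 \<ge> 1\<close>
  there, and \<open>m \<le> d ^ 2\<close> bounds the others independently of
  \<open>k\<close>.\<close>

lemma matching_profile_concentrated:
  assumes d: "d \<ge> 3" and m: "d \<le> m" "m \<le> d ^ 2"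
  shows "\<exists>w. matching_profile d (m + d * (d - 1) * k) w \<and> w 0 > 0 \<and>
    (\<Sum>j\<in>{1..<d}. w j) * 2 ^ k \<le> (d - 1) * fact (d ^ 2) * w 0"
proof -
  obtain w where w: "matching_profile d m w" "w 0 > 0" "\<And>j. w j \<le> fact m"
    using matching_profile_base[of d m] d m(1) by auto
  define a :: nat where "a = fact (d - 1) ^ (k * (d - 1))"
  define w' where "w' j = a * (d - 1) ^ (if j \<in> {1..<d} then k * (d - 2) else k * (d - 1)) * w j" for j
  have "matching_profile d (m + d * (d - 1) * k) w'"
    using matching_profile_amplify[OF w(1), of k] unfolding w'_def a_def .
  moreover have "w' 0 > 0" using w(2) d by (simp add: w'_def a_def)
  moreover have "(\<Sum>j\<in>{1..<d}. w' j) * 2 ^ k \<le> (d - 1) * fact (d ^ 2) * w' 0"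
  proof -
    have "(\<Sum>j\<in>{1..<d}. w' j) \<le> (\<Sum>j\<in>{1..<d}. a * (d - 1) ^ (k * (d - 2)) * fact (d ^ 2))"
    proof (rule sum_mono)
      fix j assume j: "j \<in> {1..<d}"
      have "w j \<le> fact (d ^ 2)" using w(3)[of j] fact_mono_nat[OF m(2)] by linarith
      then show "w' j \<le> a * (d - 1) ^ (k * (d - 2)) * fact (d ^ 2)"
        using j by (simp add: w'_def)
    qed
    also have "\<dots> = (d - 1) * fact (d ^ 2) * (a * (d - 1) ^ (k * (d - 2)))" by simp
    \<comment> \<open>Here \<open>d \<ge> 3\<close> gives
      \<open>2 ^ k \<le> (d - 1) ^ k\<close>.\<close>
    finally have "(\<Sum>j\<in>{1..<d}. w' j) * 2 ^ k \<le>
        (d - 1) * fact (d ^ 2) * (a * (d - 1) ^ (k * (d - 2))) * (d - 1) ^ k"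
      using d by (intro mult_mono power_mono) auto
    also have "\<dots> = (d - 1) * fact (d ^ 2) * (a * (d - 1) ^ (k * (d - 2) + k))"
      by (simp add: power_add mult_ac)
    also have "k * (d - 2) + k = k * (d - 1)"
    proof -
      have "d - 1 = Suc (d - 2)" using d by simp
      then show ?thesis by simp
    qed
    also have "a * (d - 1) ^ (k * (d - 1)) \<le> w' 0" using w(2) by (simp add: w'_def)
    finally show ?thesis by simp
  qed
  ultimately show ?thesis by blast
qed

theorem theorem1p7:
  fixes d :: nat
  assumes "d \<ge> 3"
  shows "\<exists>c::real. 0 < c \<and> c < 1 \<and>
           (\<forall>n::nat. n \<ge> d \<longrightarrow>
              (\<exists>(V :: nat set) (E :: nat set set) e.
                 finite_simple_graph V E \<and> bipartite_graph V E \<and> regular_graph d V E \<and>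
                 card V = 2 * n \<and> e \<in> E \<and> edge_prob V E e > 1 - c ^ n))"
proof -
  define D :: real where "D = real ((d - 1) * fact (d ^ 2))"
  have "(d - 1) * fact (d ^ 2) \<ge> 1" using assms by simp
  then have D: "D \<ge> 1" unfolding D_def by (metis of_nat_1 of_nat_le_iff)
  \<comment> \<open>Chosen so that \<open>x * 2 ^ (k + 1) = 2 ^ k / D\<close>, which fits the chord
    bound to the odds of \<open>e\<close>.\<close>
  define x where "x = 1 / (2 * D)"
  have x: "0 < x" "x \<le> 1" using D by (auto simp: x_def)
  \<comment> \<open>The root compensates for \<open>n \<le> d ^ 2 * (k + 1)\<close>, so that
    \<open>c ^ n\<close> is at least \<open>1 / (1 + x) ^ (k + 1)\<close>.\<close>
  define c where "c = root (d ^ 2) (1 / (1 + x))"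
  have c: "0 < c" "c < 1" using x assms by (auto simp: c_def)
  have "\<exists>(V :: nat set) (E :: nat set set) e.
      finite_simple_graph V E \<and> bipartite_graph V E \<and> regular_graph d V E \<and>
      card V = 2 * n \<and> e \<in> E \<and> edge_prob V E e > 1 - c ^ n" if n: "n \<ge> d" for n
  proof -
    \<comment> \<open>A round adds \<open>d * (d - 1)\<close> to the class size; dividing
      \<open>n - d\<close> by this gives the base size \<open>m\<close> and the number
      \<open>k\<close> of rounds.\<close>
    define m where "m = d + (n - d) mod (d * (d - 1))"
    define k where "k = (n - d) div (d * (d - 1))"
    have nmk: "n = m + d * (d - 1) * k"
      using n mod_mult_div_eq[of "n - d" "d * (d - 1)"] by (simp add: m_def k_def)
    have dd: "d ^ 2 = d + d * (d - 1)" using assms by (cases d) (auto simp: power2_eq_square)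
    have "(n - d) mod (d * (d - 1)) < d * (d - 1)" using assms by simp
    then have m: "d \<le> m" "m \<le> d ^ 2" unfolding m_def dd by linarith+
    obtain w where w: "matching_profile d n w" "w 0 > 0"
      and le: "(\<Sum>j\<in>{1..<d}. w j) * 2 ^ k \<le> (d - 1) * fact (d ^ 2) * w 0"
      using matching_profile_concentrated[OF assms m, of k] nmk by auto
    define s where "s = real (\<Sum>j\<in>{1..<d}. w j)"
    have s: "s \<ge> 0" "s * 2 ^ k \<le> D * w 0"
    proof -
      show "s \<ge> 0" unfolding s_def by (rule of_nat_0_le_iff)
      have "real ((\<Sum>j\<in>{1..<d}. w j) * 2 ^ k) \<le> real ((d - 1) * fact (d ^ 2) * w 0)"
        using le by (rule of_nat_mono)
      then show "s * 2 ^ k \<le> D * w 0" by (simp add: s_def D_def)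
    qed
    have "{..<d} = insert 0 {1..<d}" using assms by auto
    then have total: "real (\<Sum>j<d. w j) = w 0 + s" by (simp add: s_def)
    have "n \<le> d ^ 2 * (k + 1)" using m(2) unfolding nmk dd by (simp add: algebra_simps)
    then have "c ^ (d ^ 2 * (k + 1)) \<le> c ^ n" using c by (intro power_decreasing) auto
    moreover have "c ^ (d ^ 2) = 1 / (1 + x)"
      unfolding c_def using x assms by (intro real_root_pow_pos2) auto
    ultimately have cn: "1 / (1 + x) ^ (k + 1) \<le> c ^ n"
      by (simp only: power_mult power_one_over)
    have "(1 + x) ^ (k + 1) \<le> 1 + x * (2 ^ (k + 1) - 1)"
      using x by (intro power_one_plus_le) auto
    \<comment> \<open>The \<open>- 1\<close> in the chord bound leaves a slack of \<open>x\<close>,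
      whence the strict inequality.\<close>
    also have "\<dots> < 1 + 2 ^ k / D" using D by (simp add: x_def field_simps)
    finally have "1 / (1 + 2 ^ k / D) < 1 / (1 + x) ^ (k + 1)"
      using x D by (intro divide_strict_left_mono mult_pos_pos) (auto intro: add_pos_nonneg)
    \<comment> \<open>The left side is the probability of avoiding \<open>e\<close>; multiplied out,
      the claim is \<open>s * 2 ^ k \<le> D * w 0\<close>.\<close>
    moreover have "s / (w 0 + s) \<le> 1 / (1 + 2 ^ k / D)"
      using s w(2) D by (simp add: field_simps add_pos_nonneg)
    ultimately have "s / (w 0 + s) < c ^ n" using cn by linarith
    moreover have "w 0 / (w 0 + s) = 1 - s / (w 0 + s)"
      using s(1) w(2) by (simp add: field_simps)
    ultimately have "w 0 / real (\<Sum>j<d. w j) > 1 - c ^ n" unfolding total by linarith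
    moreover have "d > 0" using assms by simp
    moreover obtain V :: "nat set" and E and e where "finite_simple_graph V E" "bipartite_graph V E"
      "regular_graph d V E" "card V = 2 * n" "e \<in> E"
      "edge_prob V E e = w 0 / real (\<Sum>j<d. w j)"
      using matching_profile_imp_edge[OF w(1) \<open>d > 0\<close> w(2)] by auto
    ultimately show ?thesis by (intro exI[of _ V] exI[of _ E] exI[of _ e]) simp
  qed
  then show ?thesis using c by blast
qed

end
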